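(* Let $X_0 \subset \mathbb{R}^n$, $f:\mathbb{R}^n \times \mathbb{R}^{m_u} \times \mathbb{R}^{m_w} \to \mathbb{R}^n$, $T>0$, $Y \subset \mathbb{R}^{m_u}$ and $\gamma \ge 0$, and assume that solutions of the ODE $\dot x(t)=f(x(t),u(t),w(t))$ exist and are unique (so that the solution map $\phi_f$ is well defined). Suppose there exist functions $g_X: \mathbb{R}^n \to \mathbb{R}$, $g_U: \mathbb{R}^{m_u} \to \mathbb{R}$ and $g_C: \mathbb{R}^n \to \mathbb{R}$ such that $X_0 \subseteq \{x \in \mathbb{R}^n : g_X(x) \ge 0\}$, $Y \subseteq \{u \in \mathbb{R}^{m_u} : g_U(u) \ge 0\}$, and $FR(X_0,f,t,Y,\gamma) \subseteq \{x \in \mathbb{R}^n : g_C(x) \ge 0\}$ for all $t \in [0,T]$. Let $h(t)=t(T-t)$ and $d\in\mathbb{N}$. If the matrix-valued function $t\mapsto P(t)$ solves the optimization problem $S_1(d,T,f,\gamma,g_X,g_C,g_U,h)$ (defined in the context), then $$FR(X_0,f,T,Y,\gamma) \subseteq \{x \in \mathbb{R}^n : z_d(x)^TP(T)z_d(x) \le 1+\gamma\}.$$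
   Context: For $\tau>0$, $L_2^m[0,\tau]$ denotes the set of (measurable) functions $g:\mathbb{R}\to\mathbb{R}^m$ with $\int_0^\tau g(t)^Tg(t)\,dt<\infty$. For a horizon $\tau>0$, $Y\subset\mathbb{R}^{m_u}$ and $\gamma\ge 0$, the admissible input sets are $U_Y=\{u\in L_2^{m_u}[0,\tau]: u(t)\in Y \text{ for all } t\in[0,\tau]\}$ and $W_\gamma=\{w\in L_2^{m_w}[0,\tau]: \int_0^\tau w(t)^Tw(t)\,dt<\gamma\}$. Solution map: for an initial condition $x\in\mathbb{R}^n$ and inputs $u\in L_2^{m_u}[0,\tau]$, $w\in L_2^{m_w}[0,\tau]$, $\phi_f(x,u,w,\cdot)$ denotes the solution on $[0,\tau]$ of $\frac{\partial}{\partial t}\phi_f(x,u,w,t)=f(\phi_f(x,u,w,t),u(t),w(t))$ with $\phi_f(x,u,w,0)=x$; since inputs are only $L_2$ functions of time, this is understood as an absolutely continuous function satisfying the equation for almost every $t$. Existence and uniqueness of solution maps is a standing assumption. Forward reachable set: for $X_0\subset\mathbb{R}^n$ and $\tau>0$, $FR(X_0,f,\tau,Y,\gamma)=\{y\in\mathbb{R}^n: \exists x\in X_0,\ u\in U_Y,\ w\in W_\gamma \text{ such that } \phi_f(x,u,w,\tau)=y\}$, with $U_Y$, $W_\gamma$ taken with horizon $\tau$. For $\tau=0$ the reachable set is $X_0$. $z_d(x)$ is the vector of all monomials in $x\in\mathbb{R}^n$ of degree at most $d$, and $N$ is its length. $S^N_{++}$ is the set of positive definite $N\times N$ matrices. A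 polynomial $p$ is Sum-of-Squares (SOS) if $p=\sum_{i=1}^k p_i^2$ for some polynomials $p_i$; $\sum_{SOS}$ is the set of SOS polynomials (in the indicated variables). $\nabla_x V=(\partial V/\partial x_1,\dots,\partial V/\partial x_n)$. The optimization problem $S_1(d,T,f,\gamma,g_X,g_C,g_U,h)$ is: minimize $-\log\det P(T)$ over differentiable functions $P$ from $\mathbb{R}$ to symmetric $N\times N$ matrices with $P(T)\in S^N_{++}$, together with multipliers $s_1(x)$, $s_2(x,u,w,t)$, $s_3(x,u,w,t)$, $s_4(x,u,w,t)$, subject to: with $V(x,t)=z_d(x)^TP(t)z_d(x)$, one has $s_i\in\sum_{SOS}$ for $i=1,2,3,4$ and $k_1,k_2\in\sum_{SOS}$, where $$k_1(x)=(1-V(x,0))-s_1(x)g_X(x),$$ $$k_2(x,u,w,t)=-\Big(\tfrac{\partial V}{\partial t}(x,t)+\nabla_xV(x,t)^Tf(x,u,w)-w^Tw\Big)-s_2(x,u,w,t)g_C(x)-s_3(x,u,w,t)h(t)-s_4(x,u,w,t)g_U(u).$$ "$P$ solves $S_1$" means that $P$, together with some multipliers $s_i$, is an optimal (in particular feasible) solution. *)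

theory Defs
  imports "HOL-Analysis.Analysis" "Jordan_Normal_Form.Determinant"
begin

no_notation vec_index (infixl \<open>$\<close> 100)
no_notation scalar_prod (infix \<open>\<bullet>\<close> 70)

section \<open>Admissible inputs, solutions and reachable sets\<close>

definition L2_on :: "real \<Rightarrow> (real \<Rightarrow> real ^ 'm) set" where
  "L2_on \<tau> = {g. g \<in> borel_measurable lebesgue \<and>
                 set_integrable lebesgue {0..\<tau>} (\<lambda>t. g t \<bullet> g t)}"

definition U_inputs :: "real \<Rightarrow> (real ^ 'm) set \<Rightarrow> (real \<Rightarrow> real ^ 'm) set" where
  "U_inputs \<tau> Y = {u \<in> L2_on \<tau>. \<forall>t\<in>{0..\<tau>}. u t \<in> Y}"

definition W_inputs :: "real \<Rightarrow> real \<Rightarrow> (real \<Rightarrow> real ^ 'm) set" where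
  "W_inputs \<tau> \<gamma> = {w \<in> L2_on \<tau>. (LINT t:{0..\<tau>}|lebesgue. w t \<bullet> w t) < \<gamma>}"

text \<open>The usual \<open>\<epsilon>\<close>-\<open>\<delta>\<close> absolute continuity of a function (the library constant
  \<^const>\<open>absolutely_continuous\<close> is about measures). The members of \<open>D\<close> are finitely many
  non-overlapping compact intervals.\<close>

definition abs_cont_on :: "real set \<Rightarrow> (real \<Rightarrow> 'a::metric_space) \<Rightarrow> bool" where
  "abs_cont_on S \<phi> \<longleftrightarrow>
     (\<forall>\<epsilon>>0. \<exists>\<delta>>0. \<forall>D. D division_of \<Union>D \<and> \<Union>D \<subseteq> S \<and> (\<Sum>K\<in>D. Sup K - Inf K) < \<delta>
        \<longrightarrow> (\<Sum>K\<in>D. dist (\<phi> (Inf K)) (\<phi> (Sup K))) < \<epsilon>)"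

definition ode_solution ::
  "(real ^ 'n \<Rightarrow> real ^ 'mu \<Rightarrow> real ^ 'mw \<Rightarrow> real ^ 'n) \<Rightarrow> real \<Rightarrow> real ^ 'n
     \<Rightarrow> (real \<Rightarrow> real ^ 'mu) \<Rightarrow> (real \<Rightarrow> real ^ 'mw) \<Rightarrow> (real \<Rightarrow> real ^ 'n) \<Rightarrow> bool" where
  "ode_solution f \<tau> x u w \<phi> \<longleftrightarrow>
     abs_cont_on {0..\<tau>} \<phi> \<and> \<phi> 0 = x \<and>
     (AE t in lebesgue. t \<in> {0..\<tau>} \<longrightarrow>
        (\<phi> has_vector_derivative f (\<phi> t) (u t) (w t)) (at t within {0..\<tau>}))"

text \<open>Solutions are total functions on \<^typ>\<open>real\<close>, so uniqueness means agreement on \<open>{0..\<tau>}\<close>.\<close>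

definition unique_solutions ::
  "(real ^ 'n \<Rightarrow> real ^ 'mu \<Rightarrow> real ^ 'mw \<Rightarrow> real ^ 'n) \<Rightarrow> real \<Rightarrow> bool" where
  "unique_solutions f \<tau> \<longleftrightarrow>
     (\<forall>x. \<forall>u\<in>L2_on \<tau>. \<forall>w\<in>L2_on \<tau>.
        (\<exists>\<phi>. ode_solution f \<tau> x u w \<phi>) \<and>
        (\<forall>\<phi> \<psi>. ode_solution f \<tau> x u w \<phi> \<longrightarrow> ode_solution f \<tau> x u w \<psi>
           \<longrightarrow> (\<forall>t\<in>{0..\<tau>}. \<phi> t = \<psi> t)))"

definition solution_map ::
  "(real ^ 'n \<Rightarrow> real ^ 'mu \<Rightarrow> real ^ 'mw \<Rightarrow> real ^ 'n) \<Rightarrow> real \<Rightarrow> real ^ 'n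
     \<Rightarrow> (real \<Rightarrow> real ^ 'mu) \<Rightarrow> (real \<Rightarrow> real ^ 'mw) \<Rightarrow> real \<Rightarrow> real ^ 'n" where
  "solution_map f \<tau> x u w = (SOME \<phi>. ode_solution f \<tau> x u w \<phi>)"

definition FR ::
  "(real ^ 'n) set \<Rightarrow> (real ^ 'n \<Rightarrow> real ^ 'mu \<Rightarrow> real ^ 'mw \<Rightarrow> real ^ 'n) \<Rightarrow> real
     \<Rightarrow> (real ^ 'mu) set \<Rightarrow> real \<Rightarrow> (real ^ 'n) set" where
  "FR X\<^sub>0 f \<tau> Y \<gamma> =
     (if \<tau> = 0 then X\<^sub>0
      else {y. \<exists>x\<in>X\<^sub>0. \<exists>u\<in>U_inputs \<tau> Y. \<exists>w\<in>W_inputs \<tau> \<gamma>. solution_map f \<tau> x u w \<tau> = y})"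

section \<open>Monomials and sums of squares\<close>

definition exponents :: "nat \<Rightarrow> ('n::finite \<Rightarrow> nat) set" where
  "exponents d = {\<alpha>. sum \<alpha> UNIV \<le> d}"

definition monomial :: "('n::finite \<Rightarrow> nat) \<Rightarrow> real ^ 'n \<Rightarrow> real" where
  "monomial \<alpha> x = (\<Prod>i\<in>UNIV. (x $ i) ^ \<alpha> i)"

definition num_monomials :: "'n::finite itself \<Rightarrow> nat \<Rightarrow> nat" where
  "num_monomials _ d = card (exponents d :: ('n \<Rightarrow> nat) set)"

text \<open>The order of the monomials in \<open>z\<^sub>d\<close> is arbitrary, but the same throughout.\<close>

definition exponent_list :: "nat \<Rightarrow> ('n::finite \<Rightarrow> nat) list" where
  "exponent_list d = (SOME as. distinct as \<and> set as = exponents d)"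

definition z_d :: "nat \<Rightarrow> real ^ 'n \<Rightarrow> real Matrix.vec" where
  "z_d d x = vec_of_list (map (\<lambda>\<alpha>. monomial \<alpha> x) (exponent_list d))"

lemma finite_exponents: "finite (exponents d :: ('n::finite \<Rightarrow> nat) set)"
proof (rule finite_subset)
  show "(exponents d :: ('n \<Rightarrow> nat) set) \<subseteq> Pi\<^sub>E UNIV (\<lambda>_. {..d})"
  proof
    fix \<alpha> :: "'n \<Rightarrow> nat" assume a: "\<alpha> \<in> exponents d"
    have "\<alpha> i \<le> d" for i
      using member_le_sum[of i UNIV \<alpha>] a by (simp add: exponents_def)
    then show "\<alpha> \<in> Pi\<^sub>E UNIV (\<lambda>_. {..d})" by auto
  qed
qed (auto intro: finite_PiE)

lemma exponent_list:
  "distinct (exponent_list d :: ('n::finite \<Rightarrow> nat) list)"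
  "set (exponent_list d :: ('n \<Rightarrow> nat) list) = exponents d"
proof -
  obtain as :: "('n \<Rightarrow> nat) list" where "distinct as \<and> set as = exponents d"
    using finite_distinct_list[OF finite_exponents] by blast
  then have "distinct (exponent_list d :: ('n \<Rightarrow> nat) list) \<and>
      set (exponent_list d :: ('n \<Rightarrow> nat) list) = exponents d"
    unfolding exponent_list_def by (rule someI)
  then show "distinct (exponent_list d :: ('n \<Rightarrow> nat) list)"
    "set (exponent_list d :: ('n \<Rightarrow> nat) list) = exponents d" by auto
qed

lemma dim_z_d: "dim_vec (z_d d (x :: real ^ 'n)) = num_monomials TYPE('n) d"
  using distinct_card[OF exponent_list(1)[where 'n = 'n, of d]]
  by (simp add: z_d_def num_monomials_def exponent_list(2))

text \<open>Polynomials are represented by the functions they induce; over the reals this loses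
  nothing, and it lets the data \<open>f\<close>, \<open>g\<^sub>X\<close>, \<open>g\<^sub>C\<close>, \<open>g\<^sub>U\<close> below be arbitrary functions.\<close>

definition SOS :: "('a::real_normed_vector \<Rightarrow> real) set" where
  "SOS = {q. \<exists>k::nat. \<exists>p. (\<forall>i<k. real_polynomial_function (p i)) \<and>
                q = (\<lambda>y. \<Sum>i<k. (p i y)\<^sup>2)}"

section \<open>The optimization problem\<close>

definition sym_mats :: "nat \<Rightarrow> real mat set" where
  "sym_mats N = {A \<in> carrier_mat N N. transpose_mat A = A}"

definition pos_def_mats :: "nat \<Rightarrow> real mat set" where
  "pos_def_mats N =
     {A \<in> sym_mats N. \<forall>v\<in>carrier_vec N. v \<noteq> 0\<^sub>v N \<longrightarrow> scalar_prod v (A *\<^sub>v v) > 0}"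

definition V_of :: "nat \<Rightarrow> (real \<Rightarrow> real mat) \<Rightarrow> real ^ 'n \<Rightarrow> real \<Rightarrow> real" where
  "V_of d P x t = scalar_prod (z_d d x) (P t *\<^sub>v z_d d x)"

definition gradient :: "(real ^ 'n \<Rightarrow> real) \<Rightarrow> real ^ 'n \<Rightarrow> real ^ 'n" where
  "gradient g x = (\<chi> i. deriv (\<lambda>s. g (x + s *\<^sub>R axis i 1)) 0)"

definition S1_k1 ::
  "nat \<Rightarrow> (real ^ 'n \<Rightarrow> real) \<Rightarrow> (real \<Rightarrow> real mat) \<Rightarrow> (real ^ 'n \<Rightarrow> real)
     \<Rightarrow> real ^ 'n \<Rightarrow> real" where
  "S1_k1 d g\<^sub>X P s\<^sub>1 x = (1 - V_of d P x 0) - s\<^sub>1 x * g\<^sub>X x"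

definition S1_k2 ::
  "nat \<Rightarrow> (real ^ 'n \<Rightarrow> real ^ 'mu \<Rightarrow> real ^ 'mw \<Rightarrow> real ^ 'n)
     \<Rightarrow> (real ^ 'n \<Rightarrow> real) \<Rightarrow> (real ^ 'mu \<Rightarrow> real) \<Rightarrow> (real \<Rightarrow> real) \<Rightarrow> (real \<Rightarrow> real mat)
     \<Rightarrow> ((real ^ 'n) \<times> (real ^ 'mu) \<times> (real ^ 'mw) \<times> real \<Rightarrow> real)
     \<Rightarrow> ((real ^ 'n) \<times> (real ^ 'mu) \<times> (real ^ 'mw) \<times> real \<Rightarrow> real)
     \<Rightarrow> ((real ^ 'n) \<times> (real ^ 'mu) \<times> (real ^ 'mw) \<times> real \<Rightarrow> real)
     \<Rightarrow> (real ^ 'n) \<times> (real ^ 'mu) \<times> (real ^ 'mw) \<times> real \<Rightarrow> real" where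
  "S1_k2 d f g\<^sub>C g\<^sub>U h P s\<^sub>2 s\<^sub>3 s\<^sub>4 = (\<lambda>(x, u, w, t).
     - (deriv (\<lambda>r. V_of d P x r) t + gradient (\<lambda>y. V_of d P y t) x \<bullet> f x u w - w \<bullet> w)
     - s\<^sub>2 (x, u, w, t) * g\<^sub>C x - s\<^sub>3 (x, u, w, t) * h t - s\<^sub>4 (x, u, w, t) * g\<^sub>U u)"

definition S1_feasible ::
  "nat \<Rightarrow> real \<Rightarrow> (real ^ 'n \<Rightarrow> real ^ 'mu \<Rightarrow> real ^ 'mw \<Rightarrow> real ^ 'n)
     \<Rightarrow> (real ^ 'n \<Rightarrow> real) \<Rightarrow> (real ^ 'n \<Rightarrow> real) \<Rightarrow> (real ^ 'mu \<Rightarrow> real) \<Rightarrow> (real \<Rightarrow> real)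
     \<Rightarrow> (real \<Rightarrow> real mat) \<Rightarrow> bool" where
  "S1_feasible d T f g\<^sub>X g\<^sub>C g\<^sub>U h P \<longleftrightarrow>
     (\<forall>t. P t \<in> sym_mats (num_monomials TYPE('n) d)) \<and>
     (\<forall>i < num_monomials TYPE('n) d. \<forall>j < num_monomials TYPE('n) d.
        \<forall>t. (\<lambda>r. P r $$ (i, j)) differentiable (at t)) \<and>
     P T \<in> pos_def_mats (num_monomials TYPE('n) d) \<and>
     (\<exists>s\<^sub>1\<in>SOS. \<exists>s\<^sub>2\<in>SOS. \<exists>s\<^sub>3\<in>SOS. \<exists>s\<^sub>4\<in>SOS.
        S1_k1 d g\<^sub>X P s\<^sub>1 \<in> SOS \<and> S1_k2 d f g\<^sub>C g\<^sub>U h P s\<^sub>2 s\<^sub>3 s\<^sub>4 \<in> SOS)"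

definition S1_objective :: "real \<Rightarrow> (real \<Rightarrow> real mat) \<Rightarrow> real" where
  "S1_objective T P = - ln (Determinant.det (P T))"

text \<open>The multipliers do not enter the objective, so they are quantified away in
  \<^const>\<open>S1_feasible\<close>. The parameter \<open>\<gamma>\<close> belongs to the problem data, but neither the
  constraints nor the objective depend on it.\<close>

definition solves_S1 ::
  "nat \<Rightarrow> real \<Rightarrow> (real ^ 'n \<Rightarrow> real ^ 'mu \<Rightarrow> real ^ 'mw \<Rightarrow> real ^ 'n) \<Rightarrow> real
     \<Rightarrow> (real ^ 'n \<Rightarrow> real) \<Rightarrow> (real ^ 'n \<Rightarrow> real) \<Rightarrow> (real ^ 'mu \<Rightarrow> real) \<Rightarrow> (real \<Rightarrow> real)
     \<Rightarrow> (real \<Rightarrow> real mat) \<Rightarrow> bool" where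
  "solves_S1 d T f \<gamma> g\<^sub>X g\<^sub>C g\<^sub>U h P \<longleftrightarrow>
     S1_feasible d T f g\<^sub>X g\<^sub>C g\<^sub>U h P \<and>
     (\<forall>Q. S1_feasible d T f g\<^sub>X g\<^sub>C g\<^sub>U h Q \<longrightarrow> S1_objective T P \<le> S1_objective T Q)"

end

theory Submission
  imports Defs
begin

text \<open>Along a solution \<open>\<phi>\<close> the constraint \<open>k\<^sub>2 \<in> SOS\<close> gives \<open>d/dt V(\<phi>(t), t) \<le> w(t)\<^sup>T w(t)\<close> for almost
  every \<open>t\<close>, because \<open>\<phi>(t)\<close> lies in the reachable set at time \<open>t\<close>; integrating and using \<open>k\<^sub>1 \<in> SOS\<close>
  at time \<open>0\<close> bounds \<open>V(\<phi>(T), T)\<close> by \<open>1 + \<gamma>\<close>. The integration needs care: \<open>P\<close> is only assumed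
  differentiable, so \<open>t \<mapsto> V(\<phi>(t), t)\<close> need not be absolutely continuous and its derivative need not
  be Lebesgue integrable. The Henstock--Kurzweil integral still recovers the increment: \<open>V\<close> is a sum
  of products of an everywhere differentiable factor and an absolutely continuous one, and on the
  null set where \<open>\<phi>\<close> is not differentiable the increments of such a product over a fine tagged
  division are controlled by the tag-dependent Lipschitz bound of the first factor and the absolute
  continuity of the second.\<close>

section \<open>Henstock-Kurzweil fundamental theorem with a null exceptional set\<close>

text \<open>Continuity of \<open>F\<close> at the points of \<open>N\<close> would be too weak, as
  the Cantor function shows. In \<open>exc\<close> the coefficient \<open>D\<close> may vary with
  the tag, since it is summed only over tags in a null set; \<open>C\<close> is uniform, since it
  multiplies the summed increments of \<open>\<phi>\<close> over pieces of small total
  length.\<close>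

lemma ftc_negligible_exception:
  fixes F G :: "real \<Rightarrow> real" and \<phi> :: "real \<Rightarrow> 'a::metric_space"
  assumes ab: "a \<le> b" and N: "negligible N"
    and der: "\<And>t. t \<in> {a..b} - N \<Longrightarrow> (F has_vector_derivative G t) (at t within {a..b})"
    and AC: "abs_cont_on {a..b} \<phi>"
    and exc: "\<And>t. t \<in> {a..b} \<inter> N \<Longrightarrow> \<exists>d>0. \<exists>D. \<forall>u\<in>{a..t}. \<forall>v\<in>{t..b}.
                 v - u < d \<longrightarrow> \<bar>F v - F u\<bar> \<le> D * (v - u) + C * dist (\<phi> u) (\<phi> v)"
  shows "(G has_integral F b - F a) {a..b}"
proof -
  \<comment> \<open>With value 0 on \<open>N\<close>, tags there add nothing to the Riemann sum and
    only the increments of \<open>F\<close> remain to be estimated. The spike rule at the end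
    restores \<open>G\<close>.\<close>
  define G0 where "G0 t = (if t \<in> N then 0 else G t)" for t
  have "(G0 has_integral F b - F a) {a..b}"
    unfolding has_integral_real
  proof (intro allI impI)
    fix e :: real assume "e > 0"
    \<comment> \<open>Error shares: \<open>c * (b - a)\<close> from tags off \<open>N\<close>,
      \<open>c\<close> from the \<open>D\<close> terms, \<open>\<bar>C\<bar> * c\<close> from the
      increments of \<open>\<phi>\<close>. The summand 2 instead of 1 makes the final inequality
      strict.\<close>
    define c where "c = e / (b - a + \<bar>C\<bar> + 2)"
    have c: "c > 0" "c * (b - a + \<bar>C\<bar> + 2) = e"
      using ab \<open>e > 0\<close> by (auto simp: c_def divide_simps)
    have "\<exists>d>0. t \<in> {a..b} - N \<longrightarrow> (\<forall>y\<in>{a..b}. norm (y - t) < d \<longrightarrow>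
            norm (F y - F t - (y - t) *\<^sub>R G t) \<le> c * norm (y - t))" for t
      using der c unfolding has_vector_derivative_def has_derivative_within_alt
      by (cases "t \<in> {a..b} - N") (auto intro: exI[of _ 1])
    then obtain d1 where d1: "\<And>t. d1 t > 0"
      and d1': "\<And>t y. t \<in> {a..b} - N \<Longrightarrow> y \<in> {a..b} \<Longrightarrow> norm (y - t) < d1 t \<Longrightarrow>
            norm (F y - F t - (y - t) *\<^sub>R G t) \<le> c * norm (y - t)"
      by metis
    have "\<exists>d D. d > 0 \<and> (t \<in> {a..b} \<inter> N \<longrightarrow> (\<forall>u\<in>{a..t}. \<forall>v\<in>{t..b}.
                 v - u < d \<longrightarrow> \<bar>F v - F u\<bar> \<le> D * (v - u) + C * dist (\<phi> u) (\<phi> v)))" for t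
      using exc[of t] by (cases "t \<in> {a..b} \<inter> N") (auto intro: exI[of _ 1])
    then obtain d2 D where d2: "\<And>t. d2 t > 0"
      and d2': "\<And>t u v. t \<in> {a..b} \<inter> N \<Longrightarrow> u \<in> {a..t} \<Longrightarrow> v \<in> {t..b} \<Longrightarrow> v - u < d2 t \<Longrightarrow>
                 \<bar>F v - F u\<bar> \<le> D t * (v - u) + C * dist (\<phi> u) (\<phi> v)"
      by metis
    obtain \<delta> where \<delta>: "\<delta> > 0" and AC': "\<And>\<D>. \<D> division_of \<Union>\<D> \<Longrightarrow> \<Union>\<D> \<subseteq> {a..b} \<Longrightarrow>
        (\<Sum>K\<in>\<D>. Sup K - Inf K) < \<delta> \<Longrightarrow> (\<Sum>K\<in>\<D>. dist (\<phi> (Inf K)) (\<phi> (Sup K))) < c"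
      using AC c(1) unfolding abs_cont_on_def by meson
    \<comment> \<open>As \<open>h\<close> vanishes off a null set its Riemann sums are small, which bounds both the total length
      of the pieces tagged in \<open>N\<close> and the part of the increments controlled by \<open>D\<close>.\<close>
    define h where "h t = (if t \<in> N then \<bar>D t\<bar> + 1 else 0)" for t
    have "(h has_integral 0) {a..b}"
      using has_integral_negligible_cbox[OF N, of h a b] by (simp add: h_def)
    \<comment> \<open>In the threshold, \<open>\<delta>\<close> feeds the absolute continuity of
      \<open>\<phi>\<close> and \<open>c\<close> is the share of the \<open>D\<close> terms.\<close>
    then obtain \<gamma> where \<gamma>: "gauge \<gamma>" and \<gamma>': "\<And>p. p tagged_division_of {a..b} \<Longrightarrow> \<gamma> fine p \<Longrightarrow>
        norm ((\<Sum>(t, K)\<in>p. measure lborel K *\<^sub>R h t) - 0) < min c \<delta>"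
      unfolding has_integral_real using c \<delta> by (metis min_less_iff_conj)
    \<comment> \<open>\<open>d1 t\<close> bounds the distance of the endpoints from the tag, whereas
      \<open>d2 t\<close> bounds the length of the piece, which is at most twice the radius; hence
      the half.\<close>
    let ?\<gamma> = "\<lambda>t. \<gamma> t \<inter> ball t (min (d1 t) (d2 t / 2))"
    show "\<exists>\<gamma>. gauge \<gamma> \<and> (\<forall>p. p tagged_division_of {a..b} \<and> \<gamma> fine p \<longrightarrow>
                norm ((\<Sum>(t, K)\<in>p. measure lborel K *\<^sub>R G0 t) - (F b - F a)) < e)"
    proof (intro exI[of _ ?\<gamma>] conjI allI impI)
      show "gauge ?\<gamma>"
        using \<gamma> d1 d2 by (intro gauge_Int gauge_ball_dependent) auto
    next
      fix p assume p': "p tagged_division_of {a..b} \<and> ?\<gamma> fine p"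
      then have p: "p tagged_division_of {a..b}" and fine: "\<gamma> fine p"
        and fine': "(\<lambda>t. ball t (min (d1 t) (d2 t / 2))) fine p"
        by (auto simp: fine_Int)
      define r where "r = {(t, K) \<in> p. t \<in> N}"
      have fin: "finite p" using p by auto
      have K: "\<exists>u v. K = {u..v} \<and> u \<le> t \<and> t \<le> v \<and> a \<le> u \<and> v \<le> b" if "(t, K) \<in> p" for t K
      proof -
        obtain u v where "K = cbox u v" using p \<open>(t, K) \<in> p\<close> by blast
        moreover have "t \<in> K" "K \<subseteq> {a..b}" using p \<open>(t, K) \<in> p\<close> by blast+
        ultimately show ?thesis by (intro exI[of _ u] exI[of _ v]) auto
      qed
      have hsum: "(\<Sum>(t, K)\<in>p. measure lborel K * h t) < min c \<delta>"
        using \<gamma>'[OF p fine] by (simp only: real_norm_def real_scaleR_def diff_0_right abs_less_iff min_less_iff_conj)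
      have r_div: "r tagged_division_of \<Union>(snd ` r)"
        by (rule tagged_partial_division_of_Union_self[OF tagged_partial_division_subset[of p "{a..b}"]])
           (use p in \<open>auto simp: r_def tagged_division_of_def\<close>)
      have rD: "snd ` r division_of \<Union>(snd ` r)"
        using division_of_tagged_division[OF r_div] .
      have "(\<Sum>K\<in>snd ` r. dist (\<phi> (Inf K)) (\<phi> (Sup K))) < c"
      proof (rule AC'[OF rD])
        show "\<Union>(snd ` r) \<subseteq> {a..b}"
          using K by (fastforce simp: r_def)
        have "(\<Sum>K\<in>snd ` r. Sup K - Inf K) \<le> (\<Sum>K\<in>snd ` r. measure lborel K)"
        proof (rule sum_mono)
          fix L assume "L \<in> snd ` r"
          then obtain t where "(t, L) \<in> p" by (auto simp: r_def)
          from K[OF this] show "Sup L - Inf L \<le> measure lborel L" by auto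
        qed
        \<comment> \<open>A piece can carry two different tags only if its interior is empty, and
          then its content is 0, so summing over pieces or over tagged pieces agrees.\<close>
        also have "\<dots> = (\<Sum>(t, K)\<in>r. measure lborel K)"
          by (rule sum.over_tagged_division_lemma[OF r_div, symmetric]) (simp add: content_eq_0_interior interior_cbox)
        also have "\<dots> = (\<Sum>(t, K)\<in>p. if t \<in> N then measure lborel K else 0)"
          unfolding r_def using fin by (intro sum.mono_neutral_cong_left) (auto split: if_splits)
        also have "\<dots> \<le> (\<Sum>(t, K)\<in>p. measure lborel K * h t)"
          by (intro sum_mono) (auto simp: h_def algebra_simps)
        finally show "(\<Sum>K\<in>snd ` r. Sup K - Inf K) < \<delta>" using hsum by simp
      qed
      \<comment> \<open>\<^term>\<open>Inf {}\<close> and \<^term>\<open>Sup {}\<close> are unspecified, so the summand is set to \<open>0\<close> on empty boxes.\<close>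
      also have "(\<Sum>K\<in>snd ` r. dist (\<phi> (Inf K)) (\<phi> (Sup K)))
          = (\<Sum>K\<in>snd ` r. if K = {} then 0 else dist (\<phi> (Inf K)) (\<phi> (Sup K)))"
        using rD by (intro sum.cong) auto
      also have "\<dots> = (\<Sum>(t, K)\<in>r. if K = {} then 0 else dist (\<phi> (Inf K)) (\<phi> (Sup K)))"
        by (rule sum.over_tagged_division_lemma[OF r_div, symmetric]) auto
      also have "\<dots> = (\<Sum>(t, K)\<in>p. if t \<in> N then dist (\<phi> (Inf K)) (\<phi> (Sup K)) else 0)"
        unfolding r_def using fin K by (intro sum.mono_neutral_cong_left) (fastforce split: if_splits)+
      finally have dsum: "(\<Sum>(t, K)\<in>p. if t \<in> N then dist (\<phi> (Inf K)) (\<phi> (Sup K)) else 0) < c" .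
      have "\<bar>measure lborel K * G0 t - (F (Sup K) - F (Inf K))\<bar>
              \<le> c * measure lborel K + measure lborel K * h t
                 + \<bar>C\<bar> * (if t \<in> N then dist (\<phi> (Inf K)) (\<phi> (Sup K)) else 0)"
        if tK: "(t, K) \<in> p" for t K
      proof -
        obtain u v where uv: "K = {u..v}" "u \<le> t" "t \<le> v" "a \<le> u" "v \<le> b"
          using K[OF tK] by blast
        have "K \<subseteq> ball t (min (d1 t) (d2 t / 2))"
          using fine' tK by blast
        then have "u \<in> ball t (min (d1 t) (d2 t / 2))" "v \<in> ball t (min (d1 t) (d2 t / 2))"
          using uv by (auto simp del: mem_ball)
        then have small: "\<bar>u - t\<bar> < d1 t" "\<bar>v - t\<bar> < d1 t" "v - u < d2 t"
          using uv by (auto simp: dist_real_def)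
        show ?thesis
        proof (cases "t \<in> N")
          case False
          \<comment> \<open>Straddle estimate: the tag lies between the endpoints, so the two
            one-sided errors add up to \<open>c * (v - u)\<close>.\<close>
          have "\<bar>F u - F t - (u - t) * G t\<bar> \<le> c * \<bar>u - t\<bar>" "\<bar>F v - F t - (v - t) * G t\<bar> \<le> c * \<bar>v - t\<bar>"
            using d1'[of t u] d1'[of t v] uv small False by auto
          then have "\<bar>(v - u) * G t - (F v - F u)\<bar> \<le> c * \<bar>u - t\<bar> + c * \<bar>v - t\<bar>"
            by (simp add: algebra_simps)
          also have "\<dots> = c * (v - u)"
            using uv by (simp add: algebra_simps)
          finally show ?thesis
            using False uv by (simp add: G0_def h_def)
        next
          case True
          have "\<bar>F v - F u\<bar> \<le> D t * (v - u) + C * dist (\<phi> u) (\<phi> v)"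
            using d2'[of t u v] uv small True by auto
          moreover have "D t * (v - u) \<le> (v - u) * (\<bar>D t\<bar> + 1)"
            using uv mult_right_mono[of "D t" "\<bar>D t\<bar> + 1" "v - u"] by (simp add: mult.commute)
          moreover have "C * dist (\<phi> u) (\<phi> v) \<le> \<bar>C\<bar> * dist (\<phi> u) (\<phi> v)"
            by (intro mult_right_mono) auto
          moreover have "0 \<le> c * (v - u)" using c uv by simp
          ultimately show ?thesis
            using True uv by (simp add: G0_def h_def)
        qed
      qed
      then have "\<bar>\<Sum>(t, K)\<in>p. measure lborel K * G0 t - (F (Sup K) - F (Inf K))\<bar>
          \<le> (\<Sum>(t, K)\<in>p. c * measure lborel K + measure lborel K * h t
                 + \<bar>C\<bar> * (if t \<in> N then dist (\<phi> (Inf K)) (\<phi> (Sup K)) else 0))"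
        by (intro order.trans[OF sum_abs] sum_mono) auto
      also have "\<dots> = c * (\<Sum>(t, K)\<in>p. measure lborel K) + (\<Sum>(t, K)\<in>p. measure lborel K * h t)
                 + \<bar>C\<bar> * (\<Sum>(t, K)\<in>p. if t \<in> N then dist (\<phi> (Inf K)) (\<phi> (Sup K)) else 0)"
        by (simp add: case_prod_unfold sum.distrib sum_distrib_left)
      also have "(\<Sum>(t, K)\<in>p. measure lborel K) = b - a"
        using additive_content_tagged_division[of p a b] p ab by simp
      also have "c * (b - a) + (\<Sum>(t, K)\<in>p. measure lborel K * h t)
            + \<bar>C\<bar> * (\<Sum>(t, K)\<in>p. if t \<in> N then dist (\<phi> (Inf K)) (\<phi> (Sup K)) else 0)
          \<le> c * (b - a) + c + \<bar>C\<bar> * c"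
        using hsum dsum c(1) by (intro add_mono mult_left_mono) auto
      also have "\<dots> < e"
        using c by (simp add: algebra_simps)
      finally show "norm ((\<Sum>(t, K)\<in>p. measure lborel K *\<^sub>R G0 t) - (F b - F a)) < e"
        using additive_tagged_division_1[OF ab p, of F]
        by (simp add: case_prod_unfold sum_subtractf)
    qed
  qed
  then show ?thesis
    using N by (rule has_integral_spike[rotated 2]) (auto simp: G0_def)
qed

section \<open>Closure properties of absolutely continuous functions\<close>

text \<open>A single source for the closure properties: Lipschitz images, sums, and products of
  bounded functions all obey such an estimate. The same division is tested against \<open>f\<close>
  and \<open>g\<close> with the smaller of their two moduli.\<close>

lemma abs_cont_on_dominated:
  assumes f: "abs_cont_on S f" and g: "abs_cont_on S g"
    and le: "\<And>x y. x \<in> S \<Longrightarrow> y \<in> S \<Longrightarrow> dist (h x) (h y) \<le> B * (dist (f x) (f y) + dist (g x) (g y))"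
  shows "abs_cont_on S h"
  unfolding abs_cont_on_def
proof (intro allI impI)
  fix \<epsilon> :: real assume "\<epsilon> > 0"
  \<comment> \<open>Each of the two sums will be below \<open>c\<close>. The absolute value covers
    either sign of \<open>B\<close>, and the added 1 keeps the denominator positive when
    \<open>B = 0\<close>.\<close>
  define c where "c = \<epsilon> / (2 * (\<bar>B\<bar> + 1))"
  have c: "c > 0" "\<bar>B\<bar> * (c + c) < \<epsilon>"
  proof -
    show "c > 0" using \<open>\<epsilon> > 0\<close> by (simp add: c_def)
    then have "\<bar>B\<bar> * (c + c) < (\<bar>B\<bar> + 1) * (c + c)" by simp
    also have "\<dots> = \<epsilon>" using add_nonneg_pos[of "\<bar>B\<bar>" 1] by (simp add: c_def divide_simps)
    finally show "\<bar>B\<bar> * (c + c) < \<epsilon>" .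
  qed
  obtain \<delta>1 where \<delta>1: "\<delta>1 > 0" "\<And>D. D division_of \<Union>D \<Longrightarrow> \<Union>D \<subseteq> S \<Longrightarrow>
      (\<Sum>K\<in>D. Sup K - Inf K) < \<delta>1 \<Longrightarrow> (\<Sum>K\<in>D. dist (f (Inf K)) (f (Sup K))) < c"
    using f c(1) unfolding abs_cont_on_def by meson
  obtain \<delta>2 where \<delta>2: "\<delta>2 > 0" "\<And>D. D division_of \<Union>D \<Longrightarrow> \<Union>D \<subseteq> S \<Longrightarrow>
      (\<Sum>K\<in>D. Sup K - Inf K) < \<delta>2 \<Longrightarrow> (\<Sum>K\<in>D. dist (g (Inf K)) (g (Sup K))) < c"
    using g c(1) unfolding abs_cont_on_def by meson
  show "\<exists>\<delta>>0. \<forall>D. D division_of \<Union>D \<and> \<Union>D \<subseteq> S \<and> (\<Sum>K\<in>D. Sup K - Inf K) < \<delta>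
          \<longrightarrow> (\<Sum>K\<in>D. dist (h (Inf K)) (h (Sup K))) < \<epsilon>"
  proof (intro exI[of _ "min \<delta>1 \<delta>2"] conjI allI impI)
    fix D assume D: "D division_of \<Union>D \<and> \<Union>D \<subseteq> S \<and> (\<Sum>K\<in>D. Sup K - Inf K) < min \<delta>1 \<delta>2"
    have "(\<Sum>K\<in>D. dist (h (Inf K)) (h (Sup K)))
            \<le> (\<Sum>K\<in>D. \<bar>B\<bar> * (dist (f (Inf K)) (f (Sup K)) + dist (g (Inf K)) (g (Sup K))))"
    proof (rule sum_mono)
      \<comment> \<open>Pieces of a division are nonempty, so \<open>Inf K\<close> and
        \<open>Sup K\<close> are genuine endpoints in \<open>S\<close>, where \<open>le\<close>
        applies.\<close>
      fix K assume "K \<in> D"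
      then obtain u v where uv: "K = cbox u v" "K \<noteq> {}" and "K \<subseteq> S"
        using D by (metis Sup_le_iff division_ofD(3,4))
      then have "Inf K \<in> S" "Sup K \<in> S"
        by auto
      from le[OF this] show "dist (h (Inf K)) (h (Sup K))
            \<le> \<bar>B\<bar> * (dist (f (Inf K)) (f (Sup K)) + dist (g (Inf K)) (g (Sup K)))"
        by (rule order.trans) (intro mult_right_mono, auto)
    qed
    also have "\<dots> = \<bar>B\<bar> * ((\<Sum>K\<in>D. dist (f (Inf K)) (f (Sup K))) + (\<Sum>K\<in>D. dist (g (Inf K)) (g (Sup K))))"
      by (simp only: sum.distrib sum_distrib_left distrib_left)
    also have "\<dots> \<le> \<bar>B\<bar> * (c + c)"
      using \<delta>1(2)[of D] \<delta>2(2)[of D] D by (intro mult_left_mono add_mono) auto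
    also have "\<dots> < \<epsilon>" by (fact c(2))
    finally show "(\<Sum>K\<in>D. dist (h (Inf K)) (h (Sup K))) < \<epsilon>" .
  qed (use \<delta>1(1) \<delta>2(1) in auto)
qed

lemma abs_cont_on_subset:
  assumes "abs_cont_on S f" and "S' \<subseteq> S"
  shows "abs_cont_on S' f"
  unfolding abs_cont_on_def
proof (intro allI impI)
  fix \<epsilon> :: real assume "\<epsilon> > 0"
  then obtain \<delta> where "\<delta> > 0" "\<And>D. D division_of \<Union>D \<Longrightarrow> \<Union>D \<subseteq> S \<Longrightarrow>
      (\<Sum>K\<in>D. Sup K - Inf K) < \<delta> \<Longrightarrow> (\<Sum>K\<in>D. dist (f (Inf K)) (f (Sup K))) < \<epsilon>"
    using assms(1) unfolding abs_cont_on_def by meson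
  moreover have "\<Union>D \<subseteq> S" if "\<Union>D \<subseteq> S'" for D
    using that assms(2) by (rule order.trans)
  ultimately show "\<exists>\<delta>>0. \<forall>D. D division_of \<Union>D \<and> \<Union>D \<subseteq> S' \<and> (\<Sum>K\<in>D. Sup K - Inf K) < \<delta>
      \<longrightarrow> (\<Sum>K\<in>D. dist (f (Inf K)) (f (Sup K))) < \<epsilon>"
    by (intro exI[of _ \<delta>]) simp
qed

lemma abs_cont_on_imp_continuous_on:
  assumes "abs_cont_on {a..b} f"
  shows "continuous_on {a..b} f"
  unfolding continuous_on_iff
proof (intro ballI allI impI)
  fix x \<epsilon> assume x: "x \<in> {a..b}" and "(\<epsilon>::real) > 0"
  then obtain \<delta> where \<delta>: "\<delta> > 0" "\<And>D. D division_of \<Union>D \<Longrightarrow> \<Union>D \<subseteq> {a..b} \<Longrightarrow>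
      (\<Sum>K\<in>D. Sup K - Inf K) < \<delta> \<Longrightarrow> (\<Sum>K\<in>D. dist (f (Inf K)) (f (Sup K))) < \<epsilon>"
    using assms unfolding abs_cont_on_def by meson
  have ord: "dist (f s) (f t) < \<epsilon>" if "s \<in> {a..b}" "t \<in> {a..b}" "s \<le> t" "t - s < \<delta>" for s t
    using \<delta>(2)[of "{{s..t}}"] that division_of_self[of s t] by auto
  show "\<exists>d>0. \<forall>y\<in>{a..b}. dist y x < d \<longrightarrow> dist (f y) (f x) < \<epsilon>"
  proof (intro exI[of _ \<delta>] conjI ballI impI)
    fix y assume "y \<in> {a..b}" "dist y x < \<delta>"
    then show "dist (f y) (f x) < \<epsilon>"
      using x ord[of x y] ord[of y x]
      by (cases "x \<le> y") (auto simp: dist_real_def dist_commute)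
  qed (fact \<delta>(1))
qed

lemma continuous_on_real_interval_bounded:
  fixes f :: "real \<Rightarrow> real"
  assumes "continuous_on {a..b} f"
  obtains B where "B \<ge> 0" "\<And>t. t \<in> {a..b} \<Longrightarrow> \<bar>f t\<bar> \<le> B"
proof -
  have "bounded (f ` {a..b})"
    using assms by (intro compact_imp_bounded compact_continuous_image) auto
  then obtain B where "B > 0" "\<forall>x\<in>f ` {a..b}. norm x \<le> B"
    unfolding bounded_pos by blast
  then show thesis
    by (intro that[of B]) auto
qed

text \<open>Induction on the construction of \<open>q\<close>: bounded linear maps are Lipschitz,
  and a product is handled because both factors, being continuous along \<open>\<phi>\<close>, are
  bounded on the compact interval.\<close>

lemma abs_cont_on_polynomial:
  fixes \<phi> :: "real \<Rightarrow> 'a::real_normed_vector"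
  assumes q: "real_polynomial_function q" and \<phi>: "abs_cont_on {a..b} \<phi>"
  shows "abs_cont_on {a..b} (\<lambda>t. q (\<phi> t))"
  using q
proof (induction q rule: real_polynomial_function.induct)
  case (linear q)
  then obtain B where B: "\<And>x. norm (q x) \<le> norm x * B" "B \<ge> 0"
    using bounded_linear.nonneg_bounded by blast
  have "dist (q x) (q y) \<le> B * dist x y" for x y
    using B(1)[of "x - y"] linear
    by (simp add: dist_norm bounded_linear.linear linear_diff mult.commute)
  then have "dist (q x) (q y) \<le> B * (dist x y + dist x y)" for x y
    using B(2) by (smt (verit) mult_left_mono zero_le_dist)
  then show ?case
    by (intro abs_cont_on_dominated[OF \<phi> \<phi>])
next
  case (const c)
  show ?case
    by (rule abs_cont_on_dominated[OF \<phi> \<phi>, of _ 0]) simp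
next
  case (add f g)
  show ?case
    by (rule abs_cont_on_dominated[OF add.IH, of _ 1]) (simp add: dist_real_def)
next
  case (mult f g)
  obtain A where A: "\<And>t. t \<in> {a..b} \<Longrightarrow> \<bar>f (\<phi> t)\<bar> \<le> A"
    using continuous_on_real_interval_bounded[OF abs_cont_on_imp_continuous_on[OF mult.IH(1)]] by blast
  obtain B where B: "\<And>t. t \<in> {a..b} \<Longrightarrow> \<bar>g (\<phi> t)\<bar> \<le> B"
    using continuous_on_real_interval_bounded[OF abs_cont_on_imp_continuous_on[OF mult.IH(2)]] by blast
  show ?case
  proof (rule abs_cont_on_dominated[OF mult.IH, of _ "max A B"])
    fix s t assume st: "s \<in> {a..b}" "t \<in> {a..b}"
    have "f (\<phi> s) * g (\<phi> s) - f (\<phi> t) * g (\<phi> t)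
        = (f (\<phi> s) - f (\<phi> t)) * g (\<phi> s) + f (\<phi> t) * (g (\<phi> s) - g (\<phi> t))"
      by (simp add: algebra_simps)
    then have "dist (f (\<phi> s) * g (\<phi> s)) (f (\<phi> t) * g (\<phi> t))
        \<le> \<bar>g (\<phi> s)\<bar> * dist (f (\<phi> s)) (f (\<phi> t)) + \<bar>f (\<phi> t)\<bar> * dist (g (\<phi> s)) (g (\<phi> t))"
      by (metis abs_mult abs_triangle_ineq dist_real_def mult.commute)
    also have "\<dots> \<le> max A B * dist (f (\<phi> s)) (f (\<phi> t)) + max A B * dist (g (\<phi> s)) (g (\<phi> t))"
      using A[OF st(2)] B[OF st(1)] by (intro add_mono mult_right_mono) auto
    finally show "dist (f (\<phi> s) * g (\<phi> s)) (f (\<phi> t) * g (\<phi> t))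
        \<le> max A B * (dist (f (\<phi> s)) (f (\<phi> t)) + dist (g (\<phi> s)) (g (\<phi> t)))"
      by (simp add: algebra_simps)
  qed
qed

section \<open>Product rule in integrated form\<close>

text \<open>At an exceptional tag \<open>t\<close> the increment of the product splits into that of
  \<open>p\<close> times \<open>r\<close> and that of \<open>r\<close> times \<open>p\<close>. The
  first is at most a multiple of the length that depends on \<open>t\<close>; the second carries the
  uniform bound \<open>A\<close> of \<open>p\<close>. These are the \<open>D\<close> and
  \<open>C\<close> of the fundamental theorem above.\<close>

lemma has_integral_product_rule:
  fixes p r :: "real \<Rightarrow> real"
  assumes ab: "a \<le> b" and N: "negligible N"
    and p: "\<And>t. t \<in> {a..b} \<Longrightarrow> (p has_vector_derivative p' t) (at t within {a..b})"
    and AC: "abs_cont_on {a..b} r"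
    and r: "\<And>t. t \<in> {a..b} - N \<Longrightarrow> (r has_vector_derivative r' t) (at t within {a..b})"
  shows "((\<lambda>t. p' t * r t + p t * r' t) has_integral p b * r b - p a * r a) {a..b}"
proof -
  obtain A where A: "A \<ge> 0" "\<And>t. t \<in> {a..b} \<Longrightarrow> \<bar>p t\<bar> \<le> A"
    using continuous_on_real_interval_bounded[OF continuous_on_vector_derivative, OF p] by blast
  obtain B where B: "B \<ge> 0" "\<And>t. t \<in> {a..b} \<Longrightarrow> \<bar>r t\<bar> \<le> B"
    using continuous_on_real_interval_bounded[OF abs_cont_on_imp_continuous_on[OF AC]] by blast
  show ?thesis
  proof (rule ftc_negligible_exception[OF ab N _ AC, of _ _ A])
    fix t assume "t \<in> {a..b} - N"
    then show "((\<lambda>t. p t * r t) has_vector_derivative p' t * r t + p t * r' t) (at t within {a..b})"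
      using has_vector_derivative_mult[OF p r, of t] by (simp add: add.commute)
  next
    fix t assume t: "t \<in> {a..b} \<inter> N"
    \<comment> \<open>Tolerance 1 in the definition of the derivative yields the local Lipschitz
      constant \<open>\<bar>p' t\<bar> + 1\<close> at \<open>t\<close>.\<close>
    obtain d where d: "d > 0" and d': "\<And>y. y \<in> {a..b} \<Longrightarrow> norm (y - t) < d \<Longrightarrow>
        norm (p y - p t - (y - t) *\<^sub>R p' t) \<le> 1 * norm (y - t)"
    proof -
      have "(p has_vector_derivative p' t) (at t within {a..b})"
        using p t by simp
      then have "\<exists>d>0. \<forall>y\<in>{a..b}. norm (y - t) < d \<longrightarrow>
          norm (p y - p t - (y - t) *\<^sub>R p' t) \<le> 1 * norm (y - t)"
        unfolding has_vector_derivative_def has_derivative_within_alt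
        by (elim conjE allE[of _ 1]) simp
      then show thesis
        using that by blast
    qed
    have lip: "\<bar>p y - p t\<bar> \<le> (\<bar>p' t\<bar> + 1) * \<bar>y - t\<bar>" if "y \<in> {a..b}" "\<bar>y - t\<bar> < d" for y
    proof -
      have "\<bar>p y - p t\<bar> \<le> \<bar>(y - t) * p' t\<bar> + \<bar>y - t\<bar>"
      proof -
        have "\<bar>p y - p t - (y - t) * p' t\<bar> \<le> \<bar>y - t\<bar>"
          using d'[of y] that by simp
        then show ?thesis by linarith
      qed
      then show ?thesis unfolding abs_mult by (simp add: algebra_simps)
    qed
    show "\<exists>d>0. \<exists>D. \<forall>u\<in>{a..t}. \<forall>v\<in>{t..b}. v - u < d \<longrightarrow>
             \<bar>p v * r v - p u * r u\<bar> \<le> D * (v - u) + A * dist (r u) (r v)"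
    proof (rule exI[of _ d], rule conjI[OF d], rule exI[of _ "(\<bar>p' t\<bar> + 1) * B"], intro ballI impI)
      fix u v assume uv: "u \<in> {a..t}" "v \<in> {t..b}" "v - u < d"
      \<comment> \<open>The comparison passes through the tag: \<open>u \<le> t \<le> v\<close> and
        \<open>v - u < d\<close> place both endpoints within \<open>d\<close> of
        \<open>t\<close>.\<close>
      have "\<bar>p v - p u\<bar> \<le> (\<bar>p' t\<bar> + 1) * \<bar>v - t\<bar> + (\<bar>p' t\<bar> + 1) * \<bar>u - t\<bar>"
        using lip[of u] lip[of v] uv t by auto
      also have "\<dots> = (\<bar>p' t\<bar> + 1) * (v - u)"
        using uv by (simp add: algebra_simps)
      finally have pvu: "\<bar>p v - p u\<bar> \<le> (\<bar>p' t\<bar> + 1) * (v - u)" .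
      have "p v * r v - p u * r u = (p v - p u) * r v + p u * (r v - r u)"
        by (simp add: algebra_simps)
      then have "\<bar>p v * r v - p u * r u\<bar> \<le> \<bar>p v - p u\<bar> * \<bar>r v\<bar> + \<bar>p u\<bar> * \<bar>r v - r u\<bar>"
        by (metis abs_mult abs_triangle_ineq)
      also have "\<dots> \<le> ((\<bar>p' t\<bar> + 1) * (v - u)) * B + A * \<bar>r v - r u\<bar>"
        using pvu A(2)[of u] B uv t by (intro add_mono mult_mono) auto
      finally show "\<bar>p v * r v - p u * r u\<bar> \<le> (\<bar>p' t\<bar> + 1) * B * (v - u) + A * dist (r u) (r v)"
        by (simp add: dist_real_def algebra_simps abs_minus_commute)
    qed
  qed
qed

section \<open>Increment of the storage function along a solution\<close>

text \<open>Partial derivatives are values of the Frechet derivative on the coordinate axes, by the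
  chain rule along lines; linearity and the basis expansion of \<open>v\<close> recover all
  directions.\<close>

lemma gradient_inner:
  assumes "(g has_derivative g') (at x)"
  shows "gradient g x \<bullet> v = g' v"
proof -
  have lin: "linear g'"
    using assms by (simp add: has_derivative_linear)
  have "deriv (\<lambda>s. g (x + s *\<^sub>R axis i 1)) 0 = g' (axis i 1)" for i
  proof (rule DERIV_imp_deriv)
    have "((\<lambda>s. g (x + s *\<^sub>R axis i 1)) has_derivative (\<lambda>s. g' (s *\<^sub>R axis i 1))) (at 0)"
      by (rule has_derivative_compose[of "\<lambda>s. x + s *\<^sub>R axis i 1" "\<lambda>s. s *\<^sub>R axis i 1" 0 UNIV g g'])
         (use assms in \<open>auto intro!: derivative_eq_intros\<close>)
    then show "((\<lambda>s. g (x + s *\<^sub>R axis i 1)) has_field_derivative g' (axis i 1)) (at 0)"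
      by (simp add: has_field_derivative_def linear_cmul[OF lin] mult_commute_abs)
  qed
  then have "gradient g x \<bullet> v = (\<Sum>i\<in>UNIV. g' (axis i 1) * v $ i)"
    by (simp add: gradient_def inner_vec_def)
  also have "\<dots> = g' (\<Sum>i\<in>UNIV. v $ i *\<^sub>R axis i 1)"
    by (simp add: linear_sum[OF lin] linear_cmul[OF lin] mult.commute)
  also have "(\<Sum>i\<in>UNIV. v $ i *\<^sub>R axis i 1) = v"
    by (simp add: basis_expansion flip: scalar_mult_eq_scaleR)
  finally show ?thesis .
qed

lemma scalar_prod_mult_mat_vec:
  fixes A :: "'a::comm_semiring_0 mat"
  assumes "A \<in> carrier_mat N N" and "dim_vec v = N" and "dim_vec w = N"
  shows "scalar_prod v (A *\<^sub>v w)
           = (\<Sum>i<N. \<Sum>j<N. A $$ (i, j) * (vec_index v i * vec_index w j))"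
  using assms
  by (simp add: scalar_prod_def sum_distrib_left lessThan_atLeast0 ac_simps)

lemma vec_index_z_d:
  fixes x :: "real ^ 'n"
  assumes "i < num_monomials TYPE('n) d"
  shows "vec_index (z_d d x) i = monomial (exponent_list d ! i) x"
proof -
  have "length (exponent_list d :: ('n \<Rightarrow> nat) list) = num_monomials TYPE('n) d"
    using dim_z_d[of d x] by (simp add: z_d_def)
  then show ?thesis
    using assms by (simp add: z_d_def vec_of_list_index)
qed

lemma real_polynomial_function_monomial:
  fixes \<alpha> :: "'n::finite \<Rightarrow> nat"
  shows "real_polynomial_function (monomial \<alpha>)"
proof -
  have "real_polynomial_function (\<lambda>x :: real ^ 'n. \<Prod>i\<in>UNIV. (x $ i) ^ \<alpha> i)"
    by (intro real_polynomial_function_prod real_polynomial_function_power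
        real_polynomial_function.intros(1) bounded_linear_vec_nth) simp
  then show ?thesis
    by (simp add: monomial_def[abs_def])
qed

text \<open>The quadratic form separates time from state: it is a finite sum of entries
  \<open>p i j t\<close> times products of two monomials in \<open>x\<close>. Along
  \<open>\<phi>\<close> the entry is differentiable everywhere and the monomial product is
  absolutely continuous, so the product rule applies to each summand.\<close>

lemma V_of_has_integral:
  fixes f :: "real ^ 'n \<Rightarrow> real ^ 'mu \<Rightarrow> real ^ 'mw \<Rightarrow> real ^ 'n" and d :: nat
  defines "N \<equiv> num_monomials TYPE('n) d"
  assumes carrier: "\<And>t. P t \<in> carrier_mat N N"
    and diff: "\<And>i j t. i < N \<Longrightarrow> j < N \<Longrightarrow> (\<lambda>r. P r $$ (i, j)) differentiable (at t)"
    and "T \<ge> 0" and sol: "ode_solution f T x u w \<phi>"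
  shows "((\<lambda>t. deriv (\<lambda>r. V_of d P (\<phi> t) r) t
            + gradient (\<lambda>y. V_of d P y t) (\<phi> t) \<bullet> f (\<phi> t) (u t) (w t))
          has_integral V_of d P (\<phi> T) T - V_of d P (\<phi> 0) 0) {0..T}"
proof -
  define q :: "nat \<Rightarrow> nat \<Rightarrow> real ^ 'n \<Rightarrow> real"
    where "q i j x = monomial (exponent_list d ! i) x * monomial (exponent_list d ! j) x" for i j x
  define q' where "q' i j x = frechet_derivative (q i j) (at x)" for i j x
  define p where "p i j t = P t $$ (i, j)" for i j t
  define p' where "p' i j t = deriv (p i j) t" for i j t
  have V: "V_of d P x t = (\<Sum>i<N. \<Sum>j<N. p i j t * q i j x)" for x t
    unfolding V_of_def p_def q_def
    using carrier[of t] dim_z_d[of d x]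
    by (subst scalar_prod_mult_mat_vec[where N = N])
       (auto simp: N_def vec_index_z_d)
  have q_poly: "real_polynomial_function (q i j)" for i j
    unfolding q_def[abs_def]
    by (intro real_polynomial_function.intros(4) real_polynomial_function_monomial)
  have q': "(q i j has_derivative q' i j x) (at x)" for i j x
    using differentiable_at_real_polynomial_function[OF q_poly, of i j x UNIV]
    by (simp add: q'_def frechet_derivative_works)
  have p': "(p i j has_real_derivative p' i j t) (at t)" if "i < N" "j < N" for i j t
    using diff[OF that, of t] unfolding p_def[abs_def] p'_def
    by (simp add: DERIV_deriv_iff_real_differentiable)
  have AC: "abs_cont_on {0..T} \<phi>"
    using sol by (simp add: ode_solution_def)
  have "AE t in lebesgue. t \<in> {0..T} \<longrightarrow>
          (\<phi> has_vector_derivative f (\<phi> t) (u t) (w t)) (at t within {0..T})"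
    using sol by (simp add: ode_solution_def)
  then obtain M where M: "M \<in> null_sets lebesgue"
    and dphi: "\<And>t. t \<in> {0..T} - M \<Longrightarrow>
          (\<phi> has_vector_derivative f (\<phi> t) (u t) (w t)) (at t within {0..T})"
    by (auto elim!: AE_E3)
  have "((\<lambda>t. p' i j t * q i j (\<phi> t) + p i j t * q' i j (\<phi> t) (f (\<phi> t) (u t) (w t)))
      has_integral p i j T * q i j (\<phi> T) - p i j 0 * q i j (\<phi> 0)) {0..T}"
    if ij: "i < N" "j < N" for i j
  proof (rule has_integral_product_rule[OF \<open>T \<ge> 0\<close>])
    show "negligible M"
      using M by (simp add: negligible_iff_null_sets)
    show "(p i j has_vector_derivative p' i j t) (at t within {0..T})" for t
      using p'[OF ij, of t]
      by (simp add: has_real_derivative_iff_has_vector_derivative has_vector_derivative_at_within)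
    show "abs_cont_on {0..T} (\<lambda>t. q i j (\<phi> t))"
      by (rule abs_cont_on_polynomial[OF q_poly AC])
    fix t assume "t \<in> {0..T} - M"
    from vector_derivative_diff_chain_within[OF dphi[OF this] has_derivative_at_withinI[OF q']]
    show "((\<lambda>t. q i j (\<phi> t)) has_vector_derivative q' i j (\<phi> t) (f (\<phi> t) (u t) (w t)))
        (at t within {0..T})"
      by (simp add: o_def)
  qed
  then have "((\<lambda>t. \<Sum>i<N. \<Sum>j<N. p' i j t * q i j (\<phi> t) + p i j t * q' i j (\<phi> t) (f (\<phi> t) (u t) (w t)))
      has_integral (\<Sum>i<N. \<Sum>j<N. p i j T * q i j (\<phi> T) - p i j 0 * q i j (\<phi> 0))) {0..T}"
    by (intro has_integral_sum) auto
  \<comment> \<open>An identity for arbitrary \<open>y\<close> and \<open>z\<close>; taking the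
    state and the vector field along \<open>\<phi>\<close> turns the summed product rule into the
    integrand of the claim.\<close>
  moreover have "deriv (\<lambda>r. V_of d P y r) t + gradient (\<lambda>y. V_of d P y t) y \<bullet> z
      = (\<Sum>i<N. \<Sum>j<N. p' i j t * q i j y + p i j t * q' i j y z)" for t y z
  proof -
    have "((\<lambda>r. V_of d P y r) has_real_derivative (\<Sum>i<N. \<Sum>j<N. p' i j t * q i j y)) (at t)"
      unfolding V by (intro DERIV_sum DERIV_cmult_right p') auto
    then have "deriv (\<lambda>r. V_of d P y r) t = (\<Sum>i<N. \<Sum>j<N. p' i j t * q i j y)"
      by (rule DERIV_imp_deriv)
    moreover have "((\<lambda>y. V_of d P y t) has_derivative (\<lambda>z. \<Sum>i<N. \<Sum>j<N. p i j t * q' i j y z)) (at y)"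
      unfolding V by (intro has_derivative_sum has_derivative_mult_right q')
    then have "gradient (\<lambda>y. V_of d P y t) y \<bullet> z = (\<Sum>i<N. \<Sum>j<N. p i j t * q' i j y z)"
      by (rule gradient_inner)
    ultimately show ?thesis
      by (simp add: sum.distrib)
  qed
  ultimately show ?thesis
    by (simp add: V sum_subtractf)
qed

section \<open>Restriction of inputs and solutions to shorter horizons\<close>

lemma L2_on_mono: "g \<in> L2_on \<tau> \<Longrightarrow> t \<le> \<tau> \<Longrightarrow> g \<in> L2_on t"
  unfolding L2_on_def by (auto intro: set_integrable_subset)

lemma U_inputs_mono: "u \<in> U_inputs \<tau> Y \<Longrightarrow> t \<le> \<tau> \<Longrightarrow> u \<in> U_inputs t Y"
  unfolding U_inputs_def by (auto intro: L2_on_mono)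

text \<open>Passes from the Lebesgue integral to the Henstock-Kurzweil one, the common setting in
  which the input energy is compared with the increment of \<open>V\<close>.\<close>

lemma L2_on_has_integral:
  assumes "w \<in> L2_on \<tau>"
  shows "((\<lambda>t. w t \<bullet> w t) has_integral (LINT t:{0..\<tau>}|lebesgue. w t \<bullet> w t)) {0..\<tau>}"
proof -
  have "set_integrable lebesgue {0..\<tau>} (\<lambda>t. w t \<bullet> w t)"
    using assms by (simp add: L2_on_def)
  from set_lebesgue_integral_eq_integral[OF this] show ?thesis
    by (metis integrable_integral)
qed

text \<open>The integrand is nonnegative, so shortening the horizon cannot raise the energy.\<close>

lemma W_inputs_mono:
  assumes w: "w \<in> W_inputs \<tau> \<gamma>" and "t \<le> \<tau>"
  shows "w \<in> W_inputs t \<gamma>"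
proof -
  have L: "w \<in> L2_on \<tau>" "w \<in> L2_on t"
    using w \<open>t \<le> \<tau>\<close> by (auto simp: W_inputs_def intro: L2_on_mono)
  have "(LINT s:{0..t}|lebesgue. w s \<bullet> w s) \<le> (LINT s:{0..\<tau>}|lebesgue. w s \<bullet> w s)"
    using \<open>t \<le> \<tau>\<close>
    by (intro has_integral_subset_le[OF _ L2_on_has_integral[OF L(2)] L2_on_has_integral[OF L(1)]]) auto
  then show ?thesis
    using w L by (simp add: W_inputs_def)
qed

lemma ode_solution_mono:
  assumes "ode_solution f \<tau> x u w \<phi>" and "t \<le> \<tau>"
  shows "ode_solution f t x u w \<phi>"
proof -
  have sub: "{0..t} \<subseteq> {0..\<tau>}" using \<open>t \<le> \<tau>\<close> by auto
  have "AE s in lebesgue. s \<in> {0..\<tau>} \<longrightarrow>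
          (\<phi> has_vector_derivative f (\<phi> s) (u s) (w s)) (at s within {0..\<tau>})"
    using assms(1) by (simp add: ode_solution_def)
  then have "AE s in lebesgue. s \<in> {0..t} \<longrightarrow>
          (\<phi> has_vector_derivative f (\<phi> s) (u s) (w s)) (at s within {0..t})"
    by eventually_elim (use sub in \<open>auto intro: has_vector_derivative_within_subset\<close>)
  then show ?thesis
    using assms(1) abs_cont_on_subset[of "{0..\<tau>}" \<phi>, OF _ sub] by (simp add: ode_solution_def)
qed

text \<open>\<open>solution_map\<close> is an arbitrary choice made separately for each horizon;
  uniqueness ties it to any solution at hand.\<close>

lemma solution_map_eq:
  assumes "unique_solutions f \<tau>" and "u \<in> L2_on \<tau>" and "w \<in> L2_on \<tau>"
    and "ode_solution f \<tau> x u w \<phi>" and "t \<in> {0..\<tau>}"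
  shows "solution_map f \<tau> x u w t = \<phi> t"
proof -
  have "ode_solution f \<tau> x u w (solution_map f \<tau> x u w)"
    unfolding solution_map_def by (rule someI[of "ode_solution f \<tau> x u w", OF assms(4)])
  then show ?thesis
    using assms unfolding unique_solutions_def by blast
qed

lemma SOS_nonneg: "q \<in> SOS \<Longrightarrow> q y \<ge> 0"
  by (auto simp: SOS_def intro: sum_nonneg)

text \<open>For \<open>t > 0\<close> the inputs and \<open>\<phi>\<close> restrict to
  \<open>{0..t}\<close>, and uniqueness at horizon \<open>t\<close> identifies \<open>\<phi>\<close>
  there with the solution map of that horizon. For \<open>t = 0\<close> the reachable set is
  \<open>X\<^sub>0\<close> by definition.\<close>

lemma ode_solution_in_FR:
  assumes uniq: "\<And>\<tau>. 0 < \<tau> \<Longrightarrow> \<tau> \<le> T \<Longrightarrow> unique_solutions f \<tau>"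
    and x: "x \<in> X\<^sub>0" and u: "u \<in> U_inputs T Y" and w: "w \<in> W_inputs T \<gamma>"
    and sol: "ode_solution f T x u w \<phi>" and t: "t \<in> {0..T}"
  shows "\<phi> t \<in> FR X\<^sub>0 f t Y \<gamma>"
proof (cases "t = 0")
  case True
  then show ?thesis
    using x sol by (simp add: FR_def ode_solution_def)
next
  case False
  with t have t0: "0 < t" "t \<le> T" by auto
  have ut: "u \<in> U_inputs t Y" and wt: "w \<in> W_inputs t \<gamma>"
    using U_inputs_mono[OF u t0(2)] W_inputs_mono[OF w t0(2)] .
  have "solution_map f t x u w t = \<phi> t"
    using ut wt t0 uniq[OF t0] ode_solution_mono[OF sol t0(2)]
    by (intro solution_map_eq) (auto simp: U_inputs_def W_inputs_def)
  then show ?thesis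
    using False x ut wt unfolding FR_def by auto
qed

section \<open>Dissipation inequality and the final bound\<close>

theorem proposition5:
  fixes X\<^sub>0 :: "(real ^ 'n) set"
    and f :: "real ^ 'n \<Rightarrow> real ^ 'mu \<Rightarrow> real ^ 'mw \<Rightarrow> real ^ 'n"
    and T :: real and Y :: "(real ^ 'mu) set" and \<gamma> :: real
    and g\<^sub>X :: "real ^ 'n \<Rightarrow> real" and g\<^sub>U :: "real ^ 'mu \<Rightarrow> real" and g\<^sub>C :: "real ^ 'n \<Rightarrow> real"
    and d :: nat and P :: "real \<Rightarrow> real mat"
  assumes "T > 0" and "\<gamma> \<ge> 0"
    and "\<And>\<tau>. 0 < \<tau> \<Longrightarrow> \<tau> \<le> T \<Longrightarrow> unique_solutions f \<tau>"
    and "X\<^sub>0 \<subseteq> {x. g\<^sub>X x \<ge> 0}"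
    and "Y \<subseteq> {u. g\<^sub>U u \<ge> 0}"
    and "\<And>t. t \<in> {0..T} \<Longrightarrow> FR X\<^sub>0 f t Y \<gamma> \<subseteq> {x. g\<^sub>C x \<ge> 0}"
    and "solves_S1 d T f \<gamma> g\<^sub>X g\<^sub>C g\<^sub>U (\<lambda>t. t * (T - t)) P"
  shows "FR X\<^sub>0 f T Y \<gamma> \<subseteq> {x. scalar_prod (z_d d x) (P T *\<^sub>v z_d d x) \<le> 1 + \<gamma>}"
proof
  fix y assume "y \<in> FR X\<^sub>0 f T Y \<gamma>"
  then obtain x u w where x: "x \<in> X\<^sub>0" and u: "u \<in> U_inputs T Y" and w: "w \<in> W_inputs T \<gamma>"
    and y: "solution_map f T x u w T = y"
    using \<open>T > 0\<close> by (auto simp: FR_def)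
  have uL: "u \<in> L2_on T" and wL: "w \<in> L2_on T"
    using u w by (auto simp: U_inputs_def W_inputs_def)
  define \<phi> where "\<phi> = solution_map f T x u w"
  have sol: "ode_solution f T x u w \<phi>"
    using assms(3)[OF \<open>T > 0\<close>] uL wL unfolding \<phi>_def solution_map_def unique_solutions_def
    by (metis (mono_tags, lifting) order_refl someI_ex)
  let ?N = "num_monomials TYPE('n) d"
  have feas: "S1_feasible d T f g\<^sub>X g\<^sub>C g\<^sub>U (\<lambda>t. t * (T - t)) P"
    using assms(7) by (simp add: solves_S1_def)
  then obtain s1 s2 s3 s4 where SOS: "s1 \<in> SOS" "s2 \<in> SOS" "s3 \<in> SOS" "s4 \<in> SOS"
    and k1: "S1_k1 d g\<^sub>X P s1 \<in> SOS"
    and k2: "S1_k2 d f g\<^sub>C g\<^sub>U (\<lambda>t. t * (T - t)) P s2 s3 s4 \<in> SOS"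
    unfolding S1_feasible_def by blast
  have V0: "V_of d P x 0 \<le> 1"
  proof -
    have "0 \<le> s1 x * g\<^sub>X x"
      using SOS_nonneg[OF SOS(1)] x assms(4) by auto
    then show ?thesis
      using SOS_nonneg[OF k1, of x] by (simp add: S1_k1_def)
  qed
  \<comment> \<open>The left side is built from partial derivatives of \<open>V\<close>, so the
    inequality holds at every \<open>t\<close> in \<open>{0..T}\<close>, including times where
    \<open>\<phi>\<close> has no derivative: it is \<open>k\<^sub>2\<close> evaluated at
    \<open>(\<phi> t, u t, w t, t)\<close>, where all three multiplier terms are
    nonnegative.\<close>
  have dissipation: "deriv (\<lambda>r. V_of d P (\<phi> t) r) t
      + gradient (\<lambda>y. V_of d P y t) (\<phi> t) \<bullet> f (\<phi> t) (u t) (w t) \<le> w t \<bullet> w t"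
    if t: "t \<in> {0..T}" for t
  proof -
    have "\<phi> t \<in> FR X\<^sub>0 f t Y \<gamma>"
      using ode_solution_in_FR[OF assms(3) x u w sol t] .
    then have "0 \<le> s2 (\<phi> t, u t, w t, t) * g\<^sub>C (\<phi> t)"
      using SOS_nonneg[OF SOS(2)] assms(6)[OF t] by auto
    moreover have "0 \<le> s3 (\<phi> t, u t, w t, t) * (t * (T - t))"
      using SOS_nonneg[OF SOS(3)] t by auto
    moreover have "u t \<in> Y"
      using u t by (auto simp: U_inputs_def)
    then have "0 \<le> s4 (\<phi> t, u t, w t, t) * g\<^sub>U (u t)"
      using SOS_nonneg[OF SOS(4)] assms(5) by auto
    ultimately show ?thesis
      using SOS_nonneg[OF k2, of "(\<phi> t, u t, w t, t)"] by (simp add: S1_k2_def)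
  qed
  have "((\<lambda>t. deriv (\<lambda>r. V_of d P (\<phi> t) r) t
            + gradient (\<lambda>y. V_of d P y t) (\<phi> t) \<bullet> f (\<phi> t) (u t) (w t))
          has_integral V_of d P (\<phi> T) T - V_of d P (\<phi> 0) 0) {0..T}"
  proof (rule V_of_has_integral[OF _ _ _ sol])
    show "P t \<in> carrier_mat ?N ?N" for t
      using feas by (simp add: S1_feasible_def sym_mats_def)
    show "(\<lambda>r. P r $$ (i, j)) differentiable (at t)" if "i < ?N" "j < ?N" for i j t
      using feas that unfolding S1_feasible_def by blast
  qed (use \<open>T > 0\<close> in auto)
  then have "V_of d P (\<phi> T) T - V_of d P (\<phi> 0) 0 \<le> (LINT t:{0..T}|lebesgue. w t \<bullet> w t)"
    using L2_on_has_integral[OF wL] dissipation by (rule has_integral_le)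
  also have "\<dots> < \<gamma>"
    using w by (simp add: W_inputs_def)
  finally have "V_of d P (\<phi> T) T \<le> 1 + \<gamma>"
    using V0 sol by (simp add: ode_solution_def)
  then show "y \<in> {x. scalar_prod (z_d d x) (P T *\<^sub>v z_d d x) \<le> 1 + \<gamma>}"
    using y by (simp add: V_of_def \<phi>_def)
qed

end
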